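(* Assume that $\mathrm{cov}(\mathcal{M})=\mathfrak{c}$. Then there is a Menger totally imperfect set $X\subseteq 2^\omega\times 2^\omega$ with $\pi[X]=2^\omega$, where $\pi\colon 2^\omega\times 2^\omega\to 2^\omega$ is the projection onto the first coordinate.
   Context: $2^\omega$ is the Cantor space. $\mathfrak{c}$ is the cardinality of the continuum; $\mathrm{cov}(\mathcal{M})$ is the minimal cardinality of a family of meager subsets of $2^\omega$ which covers $2^\omega$. A set $X$ is Menger if for every sequence $\mathcal{U}_0,\mathcal{U}_1,\dots$ of open covers of $X$ there are finite sets $\mathcal{F}_0\subseteq\mathcal{U}_0,\mathcal{F}_1\subseteq\mathcal{U}_1,\dots$ such that the family $\{\bigcup\mathcal{F}_n: n\in\omega\}$ covers $X$. A set is totally imperfect if it contains no perfect subset, i.e. no homeomorphic copy of $2^\omega$. *)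

theory Defs
  imports "HOL-Analysis.Analysis"
begin

unbundle cardinal_syntax

text \<open>The instances of \<^class>\<open>topological_space\<close> for \<^type>\<open>bool\<close> (discrete), for functions and
  for pairs (products) give the usual topologies on Cantor space and on its square.\<close>

type_synonym cantor = "nat \<Rightarrow> bool"

definition nowhere_dense :: "'a::topological_space set \<Rightarrow> bool" where
  "nowhere_dense A \<longleftrightarrow> interior (closure A) = {}"

definition meager :: "'a::topological_space set \<Rightarrow> bool" where
  "meager A \<longleftrightarrow> (\<exists>N :: nat \<Rightarrow> 'a set. (\<forall>n. nowhere_dense (N n)) \<and> A = (\<Union>n. N n))"

definition meager_cover :: "cantor set set \<Rightarrow> bool" where
  "meager_cover F \<longleftrightarrow> (\<forall>A\<in>F. meager A) \<and> \<Union>F = UNIV"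

text \<open>Cardinals are cardinal orders of HOL, compared up to \<open>=o\<close>; the choice below is legitimate by
  the lemma \<open>cov_meager_min\<close>.\<close>

definition cov_meager :: "cantor set rel" where
  "cov_meager = (SOME \<kappa>. (\<exists>F. meager_cover F \<and> \<kappa> = |F| ) \<and> (\<forall>G. meager_cover G \<longrightarrow> \<kappa> \<le>o |G| ))"

definition continuum :: "real rel" where
  "continuum = |UNIV :: real set|"

definition open_cover :: "'a::topological_space set \<Rightarrow> 'a set set \<Rightarrow> bool" where
  "open_cover X U \<longleftrightarrow> (\<forall>V\<in>U. openin (top_of_set X) V) \<and> \<Union>U = X"

definition Menger :: "'a::topological_space set \<Rightarrow> bool" where
  "Menger X \<longleftrightarrow>
     (\<forall>U :: nat \<Rightarrow> 'a set set. (\<forall>n. open_cover X (U n)) \<longrightarrow>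
        (\<exists>F. (\<forall>n. finite (F n) \<and> F n \<subseteq> U n) \<and> X \<subseteq> (\<Union>n. \<Union>(F n))))"

definition totally_imperfect :: "'a::topological_space set \<Rightarrow> bool" where
  "totally_imperfect X \<longleftrightarrow> (\<nexists>P. P \<subseteq> X \<and> P homeomorphic (UNIV :: cantor set))"

lemma nowhere_dense_singleton: "nowhere_dense {x :: cantor}"
proof -
  have cl: "closure {x} = {x}"
  proof (rule closure_closed)
    have "open ((\<lambda>y :: cantor. y i) -` {\<not> x i})" for i
      by (rule open_vimage[OF open_discrete]) (rule continuous_on_product_coordinates)
    then have "open (\<Union>i. (\<lambda>y :: cantor. y i) -` {\<not> x i})"
      by (intro open_UN) blast
    also have "(\<Union>i. (\<lambda>y. y i) -` {\<not> x i}) = - {x}"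
      by (auto simp: fun_eq_iff)
    finally have "open (- {x})" .
    then show "closed {x}" by (simp add: closed_def)
  qed
  have "\<not> open {x}"
  proof
    assume o: "open {x}"
    define y where "y = (\<lambda>n. x(n := \<not> x n))"
    have "(\<lambda>n. y n i) \<longlonglongrightarrow> x i" for i
    proof (rule tendsto_eventually)
      show "eventually (\<lambda>n. y n i = x i) sequentially"
        unfolding eventually_sequentially y_def by (intro exI[of _ "Suc i"]) auto
    qed
    then have "limitin (product_topology (\<lambda>_. euclidean) UNIV) y x sequentially"
      by (simp add: limitin_componentwise)
    then have "y \<longlonglongrightarrow> x"
      by (simp add: euclidean_product_topology)
    then have "eventually (\<lambda>n. y n \<in> {x}) sequentially"
      by (rule topological_tendstoD[OF _ o]) simp
    then obtain n where "y n = x" by (auto simp: eventually_sequentially)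
    then have "y n n = x n" by simp
    then show False by (simp add: y_def)
  qed
  then have "interior {x} = {}"
    using interior_subset[of "{x}"] open_interior[of "{x}"] unfolding subset_singleton_iff
    by fastforce
  then show ?thesis by (simp add: nowhere_dense_def cl)
qed

lemma cov_meager_min:
  "\<exists>F. meager_cover F \<and> cov_meager = |F|"
  "meager_cover G \<Longrightarrow> cov_meager \<le>o |G|"
proof -
  have "meager {x}" for x :: cantor
    unfolding meager_def by (rule exI[of _ "\<lambda>_. {x}"]) (simp add: nowhere_dense_singleton)
  then have "meager_cover (range (\<lambda>x. {x}))" by (auto simp: meager_cover_def)
  then have "card_of ` Collect meager_cover \<noteq> {}" by blast
  moreover have "\<forall>r\<in>card_of ` Collect meager_cover. Card_order r" by (auto intro: card_of_Card_order)
  ultimately have "\<exists>r\<in>card_of ` Collect meager_cover. \<forall>r'\<in>card_of ` Collect meager_cover. r \<le>o r'"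
    by (rule exists_minim_Card_order)
  then obtain F where "meager_cover F" "\<And>G. meager_cover G \<Longrightarrow> |F| \<le>o |G|" by auto
  then have "\<exists>\<kappa>. (\<exists>F. meager_cover F \<and> \<kappa> = |F| ) \<and> (\<forall>G. meager_cover G \<longrightarrow> \<kappa> \<le>o |G| )"
    by (intro exI[of _ "|F|"]) auto
  from someI_ex[OF this]
  show "\<exists>F. meager_cover F \<and> cov_meager = |F|" "meager_cover G \<Longrightarrow> cov_meager \<le>o |G|"
    unfolding cov_meager_def by simp_all
qed

end

theory Submission
  imports Defs "HOL-Library.Countable_Set_Type"
begin

text \<open>Let \<open>Q\<close> be the countable dense set of eventually zero sequences. The set \<open>X\<close> consists of the
  points \<open>(x, f x + q)\<close> with \<open>q \<in> Q\<close> (sum modulo 2), where \<open>f\<close> is chosen along a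
  well-ordering of Cantor space in order type continuum such that, for every open \<open>W\<close> all of whose vertical sections are
  dense, \<open>X - W\<close> has size less than continuum;
  the value \<open>f x\<close> has to avoid fewer than \<open>cov(M)\<close> meager sets.
  Given open covers of \<open>X\<close>, density of \<open>Q\<close> and compactness of the first factor yield finite subfamilies
  whose union contains \<open>X \<inter> W\<close> for such a \<open>W\<close>, and sets of size less than \<open>cov(M)\<close> are Menger.
  If \<open>P \<subseteq> X\<close> is perfect, its complement is such a \<open>W\<close> because the sections of \<open>X\<close> are countable, so \<open>P\<close>
  is smaller than the continuum, which is absurd.\<close>

section \<open>The topology of Cantor space\<close>

text \<open>Through the product instances, Cantor space and its square become second countable, as
  the enumeration of open sets and the Lindelof argument require.\<close>

instance bool :: second_countable_topology
proof
  show "\<exists>B :: bool set set. countable B \<and> open = generate_topology B"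
    by (intro exI[of _ UNIV]) (auto simp: fun_eq_iff open_discrete intro: generate_topology.Basis)
qed

lemma compact_cantor: "compact (UNIV :: cantor set)"
proof -
  have "compact_space (euclidean :: bool topology)"
    by (simp add: compact_space_def finite_imp_compact)
  then have "compact_space (product_topology (\<lambda>i::nat. euclidean :: bool topology) UNIV)"
    by (simp add: compact_space_product_topology)
  then show ?thesis
    by (simp add: euclidean_product_topology compact_space_def)
qed

lemma compact_imp_closed_cantor_square:
  fixes P :: "(cantor \<times> cantor) set"
  assumes "compact P"
  shows "closed P"
proof -
  have "Hausdorff_space (euclidean :: bool topology)"
    unfolding Hausdorff_space_def by (auto simp: disjnt_iff open_discrete)
  then have "Hausdorff_space (product_topology (\<lambda>i::nat. euclidean :: bool topology) UNIV)"
    by (simp add: Hausdorff_space_product_topology)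
  then have "Hausdorff_space (euclidean :: cantor topology)"
    by (simp add: euclidean_product_topology)
  then have "Hausdorff_space (prod_topology euclidean euclidean :: (cantor \<times> cantor) topology)"
    by (simp add: Hausdorff_space_prod_topology del: prod_topology_euclidean)
  with assms show ?thesis
    using compactin_imp_closedin[of euclidean P] by simp
qed

definition cyl :: "nat \<Rightarrow> cantor \<Rightarrow> cantor set" where
  "cyl m y = {z. \<forall>i<m. z i = y i}"

lemma self_in_cyl: "y \<in> cyl m y"
  by (simp add: cyl_def)

lemma open_coordinate: "open {z :: cantor. z i = b}"
proof -
  have "open ((\<lambda>z :: cantor. z i) -` {b})"
    by (rule open_vimage[OF open_discrete]) (rule continuous_on_product_coordinates)
  then show ?thesis by (simp add: vimage_def)
qed

lemma open_cyl: "open (cyl m y)"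
proof -
  have "cyl m y = (\<Inter>i<m. {z. z i = y i})"
    by (auto simp: cyl_def)
  then show ?thesis by (simp add: open_INT open_coordinate)
qed

text \<open>If no cylinder at \<open>y\<close> fitted into \<open>V\<close>, points of the cylinders
  outside \<open>V\<close> would converge to \<open>y\<close> coordinatewise.\<close>

lemma open_imp_cyl:
  assumes "open V" "y \<in> V"
  obtains m where "cyl m y \<subseteq> V"
proof (rule ccontr)
  assume "\<not> thesis"
  then have "\<forall>m. \<exists>z. z \<in> cyl m y \<and> z \<notin> V" using that by blast
  then obtain z where z: "\<And>m. z m \<in> cyl m y" "\<And>m. z m \<notin> V" by metis
  have "(\<lambda>n. z n i) \<longlonglongrightarrow> y i" for i
  proof (rule tendsto_eventually)
    show "eventually (\<lambda>n. z n i = y i) sequentially"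
      unfolding eventually_sequentially using z(1) by (intro exI[of _ "Suc i"]) (auto simp: cyl_def)
  qed
  then have "limitin (product_topology (\<lambda>_. euclidean) UNIV) z y sequentially"
    by (simp add: limitin_componentwise)
  then have "z \<longlonglongrightarrow> y"
    by (simp add: euclidean_product_topology)
  then have "eventually (\<lambda>n. z n \<in> V) sequentially"
    using assms by (rule topological_tendstoD)
  with z(2) show False by (auto simp: eventually_sequentially)
qed

lemma uncountable_open_cantor:
  fixes V :: "cantor set"
  assumes "open V" "V \<noteq> {}"
  shows "uncountable V"
proof
  assume V: "countable V"
  obtain y where "y \<in> V" using assms by blast
  then obtain m where m: "cyl m y \<subseteq> V" using open_imp_cyl assms by blast
  \<comment> \<open>Prefixing \<open>m\<close> coordinates of \<open>y\<close> embeds all of Cantor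
    space into the cylinder; Cantor's diagonal argument then finishes.\<close>
  define j :: "cantor \<Rightarrow> cantor" where "j z = (\<lambda>i. if i < m then y i else z (i - m))" for z
  have "inj j"
  proof
    fix z z' assume "j z = j z'"
    then have "j z (i + m) = j z' (i + m)" for i by simp
    then show "z = z'" by (auto simp: j_def)
  qed
  moreover have "range j \<subseteq> V" using m by (auto simp: j_def cyl_def)
  ultimately have "countable (UNIV :: cantor set)"
    using V by (meson countable_image_inj_on countable_subset)
  then obtain e :: "nat \<Rightarrow> cantor" where e: "range e = UNIV"
    by (metis UNIV_not_empty range_from_nat_into)
  then obtain n where "e n = (\<lambda>i. \<not> e i i)" by (metis UNIV_I imageE)
  then show False by (metis (full_types))
qed

lemma nowhere_dense_Compl:
  assumes "open D" "\<And>V. open V \<Longrightarrow> V \<noteq> {} \<Longrightarrow> V \<inter> D \<noteq> {}"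
  shows "nowhere_dense (- D)"
proof -
  have "closure (- D) = - D" using assms(1) by (simp add: closed_Compl)
  moreover have "interior (- D) = {}"
    using assms(2)[OF open_interior[of "- D"]] interior_subset[of "- D"] by blast
  ultimately show ?thesis by (simp add: nowhere_dense_def)
qed

definition flip :: "cantor \<Rightarrow> cantor \<Rightarrow> cantor" where
  "flip y q = (\<lambda>i. y i \<noteq> q i)"

lemma flip_flip [simp]: "flip (flip y q) q = y"
  by (auto simp: flip_def)

lemma continuous_on_flip: "continuous_on UNIV (\<lambda>y. flip y q)"
proof (rule continuous_on_coordinatewise_then_product)
  fix i
  have "{y::cantor. (y i \<noteq> q i) \<in> B} = (\<Union>b\<in>{b. (b \<noteq> q i) \<in> B}. {y. y i = b})" for B
    by auto
  then have "open {y::cantor. (y i \<noteq> q i) \<in> B}" for B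
    by (metis (no_types, lifting) open_UN open_coordinate)
  then have "continuous_on UNIV (\<lambda>y::cantor. y i \<noteq> q i)"
    by (simp add: continuous_on_open_vimage vimage_def)
  then show "continuous_on UNIV (\<lambda>y. flip y q i)"
    by (simp add: flip_def)
qed

lemma open_vimage_flip: "open D \<Longrightarrow> open {y. flip y q \<in> D}"
  using open_vimage[OF _ continuous_on_flip] by (simp add: vimage_def)

text \<open>The binary digits of the natural numbers give exactly the eventually zero sequences.\<close>

definition digits :: "nat \<Rightarrow> cantor" where
  "digits n = bit n"

lemma flip_digits_dense:
  assumes "open V" "V \<noteq> {}"
  obtains n where "flip y (digits n) \<in> V"
proof -
  obtain v where "v \<in> V" using assms by blast
  then obtain m where m: "cyl m v \<subseteq> V" using open_imp_cyl assms by blast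
  \<comment> \<open>The first \<open>m\<close> binary digits of \<open>n\<close> mark where
    \<open>y\<close> and \<open>v\<close> differ, so adding them modulo 2 turns \<open>y\<close>
    into \<open>v\<close> there.\<close>
  define n :: nat where "n = horner_sum of_bool 2 (map (\<lambda>i. y i \<noteq> v i) [0..<m])"
  have "flip y (digits n) \<in> cyl m v"
    by (auto simp: cyl_def flip_def digits_def n_def bit_horner_sum_bit_iff)
  with m that show ?thesis by blast
qed

section \<open>Consequences of a large covering number\<close>

lemma cantor_ordIso_real: "|UNIV :: cantor set| =o |UNIV :: real set|"
proof -
  have "bij (Collect :: cantor \<Rightarrow> nat set)"
    by (rule o_bij[of "\<lambda>A x. x \<in> A"]) auto
  then have "(UNIV :: cantor set) \<approx> (UNIV :: nat set set)"
    by (auto simp: eqpoll_def)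
  then show ?thesis
    using nat_sets_eqpoll_reals eqpoll_trans eqpoll_iff_card_of_ordIso by blast
qed

lemma not_covered_by_few_meager:
  fixes M :: "'i \<Rightarrow> cantor set"
  assumes "|I| <o cov_meager" "\<And>i. i \<in> I \<Longrightarrow> meager (M i)"
  obtains y where "\<And>i. i \<in> I \<Longrightarrow> y \<notin> M i"
proof -
  have "\<not> meager_cover (M ` I)"
  proof
    assume "meager_cover (M ` I)"
    then have "cov_meager \<le>o |M ` I|" by (rule cov_meager_min)
    also have "|M ` I| \<le>o |I|" by (rule card_of_image)
    finally show False using assms(1) not_ordLess_ordLeq by blast
  qed
  then have "\<Union>(M ` I) \<noteq> UNIV" using assms(2) by (auto simp: meager_cover_def)
  with that show ?thesis by blast
qed

text \<open>A point of Cantor space codes the function mapping \<open>n\<close> to the position of the first 1 in its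
  \<open>n\<close>-th row. A generic point codes a function that meets \<open>h\<close>.\<close>

lemma few_functions_met:
  fixes \<phi> :: "'a \<Rightarrow> nat \<Rightarrow> nat"
  assumes "|Y| <o cov_meager"
  obtains g where "\<And>p. p \<in> Y \<Longrightarrow> \<exists>n. g n = \<phi> p n"
proof -
  define g :: "cantor \<Rightarrow> nat \<Rightarrow> nat" where "g z n = (LEAST k. z (prod_encode (n, k)))" for z n
  \<comment> \<open>The points for which some row \<open>n\<close> has its first 1 exactly at
    position \<open>h n\<close>.\<close>
  define D where "D h = (\<Union>n. {z. z (prod_encode (n, h n))} \<inter>
      (\<Inter>k<h n. {z. \<not> z (prod_encode (n, k))}))" for h
  have g: "\<exists>n. g z n = h n" if z: "z \<in> D h" for z h
  proof -
    obtain n where "z (prod_encode (n, h n))" "\<And>k. k < h n \<Longrightarrow> \<not> z (prod_encode (n, k))"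
      using z by (auto simp: D_def)
    then have "g z n = h n" unfolding g_def
      by (intro Least_equality) (auto simp: not_less[symmetric])
    then show ?thesis ..
  qed
  have nd: "nowhere_dense (- D h)" for h
  proof (rule nowhere_dense_Compl)
    have "open {z::cantor. z i}" "open {z::cantor. \<not> z i}" for i
      using open_coordinate[of i True] open_coordinate[of i False] by simp_all
    then show "open (D h)" unfolding D_def by (intro open_UN open_Int open_INT ballI) auto
    fix V :: "cantor set" assume V: "open V" "V \<noteq> {}"
    then obtain v where "v \<in> V" by blast
    then obtain m where m: "cyl m v \<subseteq> V" using open_imp_cyl V by blast
    \<comment> \<open>Row \<open>m\<close> lies entirely beyond the first \<open>m\<close>
      coordinates, so it can be prescribed freely: its only 1 is put at position
      \<open>h m\<close>.\<close>
    define z where "z i = (if i < m then v i else i = prod_encode (m, h m))" for i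
    have row: "m \<le> prod_encode (m, k)" for k by (rule le_prod_encode_1)
    have "z (prod_encode (m, k)) \<longleftrightarrow> k = h m" for k
      using row[of k] by (simp add: z_def leD)
    then have "z \<in> D h" unfolding D_def
      by (intro UN_I[of m]) simp_all
    moreover have "z \<in> V" using m by (auto simp: cyl_def z_def)
    ultimately show "V \<inter> D h \<noteq> {}" by blast
  qed
  have "meager (- D h)" for h
    unfolding meager_def using nd by (intro exI[of _ "\<lambda>_. - D h"]) simp
  then obtain y where "\<And>p. p \<in> Y \<Longrightarrow> y \<notin> - D (\<phi> p)"
    using not_covered_by_few_meager[OF assms, of "\<lambda>p. - D (\<phi> p)"] by blast
  with g that show ?thesis by (metis ComplI)
qed

section \<open>Open sets with dense vertical sections\<close>

definition dense_sections :: "(cantor \<times> cantor) set \<Rightarrow> bool" where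
  "dense_sections W \<longleftrightarrow> open W \<and> (\<forall>x V. open V \<longrightarrow> V \<noteq> {} \<longrightarrow> (\<exists>y\<in>V. (x, y) \<in> W))"

text \<open>The section of \<open>W\<close> at \<open>x\<close> is open and dense, and so is each of
  its countably many translates by \<open>digits n\<close>.\<close>

lemma meager_translates:
  assumes "dense_sections W"
  shows "meager {y. \<exists>n. (x, flip y (digits n)) \<notin> W}"
proof -
  let ?D = "\<lambda>n. {y. (x, flip y (digits n)) \<in> W}"
  have "nowhere_dense (- ?D n)" for n
  proof (rule nowhere_dense_Compl)
    have "open ((\<lambda>y. (x, y)) -` W)"
      using assms by (intro open_vimage continuous_intros) (simp add: dense_sections_def)
    then show "open (?D n)" using open_vimage_flip by fastforce
    fix V :: "cantor set" assume V: "open V" "V \<noteq> {}"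
    then have "open {y. flip y (digits n) \<in> V}" by (simp add: open_vimage_flip)
    moreover have "{y. flip y (digits n) \<in> V} \<noteq> {}"
      using V(2) flip_flip by (metis (mono_tags) all_not_in_conv mem_Collect_eq)
    ultimately obtain y where "flip y (digits n) \<in> V" "(x, y) \<in> W"
      using assms unfolding dense_sections_def by blast
    then have "flip y (digits n) \<in> V \<inter> ?D n" by simp
    then show "V \<inter> ?D n \<noteq> {}" by blast
  qed
  moreover have "{y. \<exists>n. (x, flip y (digits n)) \<notin> W} = (\<Union>n. - ?D n)" by auto
  ultimately show ?thesis unfolding meager_def by (intro exI[of _ "\<lambda>n. - ?D n"]) blast
qed

text \<open>An open set is determined by a set of members of a countable base, and such a set is
  coded by a 0-1 sequence. Thus the points of Cantor space can serve as indices of open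
  sets.\<close>

lemma open_enumeration:
  obtains e :: "cantor \<Rightarrow> 'a::second_countable_topology set" where "\<And>W. open W \<Longrightarrow> W \<in> range e"
proof -
  obtain B :: "'a set set" where B: "countable B" "\<And>S. open S \<Longrightarrow> \<exists>U. U \<subseteq> B \<and> S = \<Union>U"
    by (metis univ_second_countable)
  define e where "e w = \<Union>{b \<in> B. w (to_nat_on B b)}" for w :: cantor
  have "W \<in> range e" if W: "open W" for W
  proof -
    obtain U where U: "U \<subseteq> B" "W = \<Union>U" using B(2)[OF W] by blast
    have "U = {b \<in> B. to_nat_on B b \<in> to_nat_on B ` U}"
      using U(1) inj_on_to_nat_on[OF B(1)] by (auto dest: inj_onD)
    then have "W = e (\<lambda>n. n \<in> to_nat_on B ` U)" unfolding e_def U(2) by simp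
    then show ?thesis by blast
  qed
  with that show ?thesis by blast
qed

text \<open>An infinite \<open>A\<close> absorbs the countable factor; for finite \<open>A\<close>
  the product is countable.\<close>

lemma card_of_Times_nat_ordLess:
  assumes "|A| <o |B|" "uncountable B"
  shows "|A \<times> (UNIV :: nat set)| <o |B|"
proof (cases "finite A")
  case True
  then have "countable (A \<times> (UNIV :: nat set))" by (simp add: countable_finite)
  then have "|A \<times> (UNIV :: nat set)| \<le>o |UNIV :: nat set|"
    by (simp add: countable_card_of_nat)
  also have "|UNIV :: nat set| <o |B|"
    using assms(2) by (simp add: countable_card_of_nat not_ordLeq_iff_ordLess card_of_Well_order)
  finally show ?thesis .
next
  case False
  then have "|UNIV :: nat set| \<le>o |A|" by (simp add: infinite_iff_card_of_nat)
  with False have "|A \<times> (UNIV :: nat set)| =o |A|" by (simp add: card_of_Times_infinite)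
  then show ?thesis using assms(1) by (rule ordIso_ordLess_trans)
qed

text \<open>The points \<open>x\<close> of Cantor space are well-ordered in type \<open>\<cc>\<close>, and \<open>f x\<close> is chosen generic over
  the open sets with index below \<open>x\<close>.\<close>

lemma generic_function:
  assumes "cov_meager =o continuum"
  obtains f :: "cantor \<Rightarrow> cantor" where
    "\<And>W. dense_sections W \<Longrightarrow> |{(x, n). (x, flip (f x) (digits n)) \<notin> W}| <o cov_meager"
proof -
  let ?c = "|UNIV :: cantor set|"
  have cov: "?c =o cov_meager"
    using cantor_ordIso_real assms[unfolded continuum_def] ordIso_symmetric ordIso_transitive by blast
  obtain e :: "cantor \<Rightarrow> (cantor \<times> cantor) set" where e: "\<And>W. open W \<Longrightarrow> W \<in> range e"
    by (rule open_enumeration) blast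
  \<comment> \<open>The values forbidden at \<open>x\<close> on account of \<open>e b\<close>; there
    are none if \<open>e b\<close> lacks dense sections, so \<open>M x b\<close> is meager for every
    \<open>b\<close>.\<close>
  define M where "M x b = {y. dense_sections (e b) \<and> (\<exists>n. (x, flip y (digits n)) \<notin> e b)}" for x b
  have small_underS: "|underS ?c x| <o ?c" for x
    by (rule card_of_underS[OF card_of_Card_order]) (simp add: Field_card_of)
  have "\<exists>y. \<forall>b \<in> underS ?c x. y \<notin> M x b" for x
  proof -
    have small: "|underS ?c x| <o cov_meager"
      using small_underS cov by (rule ordLess_ordIso_trans)
    have "meager {}" unfolding meager_def nowhere_dense_def by (rule exI[of _ "\<lambda>_. {}"]) simp
    then have "meager (M x b)" for b
      using meager_translates[of "e b" x] by (cases "dense_sections (e b)") (simp_all add: M_def)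
    then obtain y where "\<And>b. b \<in> underS ?c x \<Longrightarrow> y \<notin> M x b"
      using not_covered_by_few_meager[OF small, of "M x"] by blast
    then show ?thesis by blast
  qed
  then obtain f where f: "\<And>x b. b \<in> underS ?c x \<Longrightarrow> f x \<notin> M x b" by metis
  have "|{(x, n). (x, flip (f x) (digits n)) \<notin> W}| <o cov_meager" if W: "dense_sections W" for W
  proof -
    have "open W" using W by (simp add: dense_sections_def)
    then obtain b where b: "W = e b" using e by blast
    have unc: "uncountable (UNIV :: cantor set)" by (rule uncountable_open_cantor) auto
    then have "infinite (UNIV :: cantor set)" using countable_finite by blast
    \<comment> \<open>Exceptions can occur only at points \<open>x\<close> up to and including
      \<open>b\<close>. Since the order has no last element, a strictly later \<open>b'\<close> puts
      them all into the small set \<open>underS ?c b'\<close>.\<close>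
    then obtain b' where b': "b \<noteq> b'" "(b, b') \<in> ?c"
      using infinite_Card_order_limit[OF card_of_Card_order, of UNIV b] by (auto simp: Field_card_of)
    have wo: "wo_rel ?c" using card_of_Well_order by (simp add: wo_rel_def)
    have total: "(y, z) \<in> ?c \<or> (z, y) \<in> ?c" for y z
      using wo_rel.TOTALS[OF wo] by (simp add: Field_card_of)
    have "x \<in> underS ?c b'" if x: "(x, flip (f x) (digits n)) \<notin> W" for x n
    proof -
      have "f x \<in> M x b" using W x unfolding b M_def by blast
      then have "b \<notin> underS ?c x" using f by blast
      then have xb: "(x, b) \<in> ?c" using total[of x b] total[of b b] by (auto simp: underS_def)
      then have "(x, b') \<in> ?c" using b'(2) wo_rel.TRANS[OF wo] by (rule transD[rotated])
      moreover have "x \<noteq> b'" using xb b' antisymD[OF wo_rel.ANTISYM[OF wo]] by blast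
      ultimately show ?thesis by (simp add: underS_def)
    qed
    then have "{(x, n). (x, flip (f x) (digits n)) \<notin> W} \<subseteq> underS ?c b' \<times> UNIV" by blast
    then have "|{(x, n). (x, flip (f x) (digits n)) \<notin> W}| \<le>o |underS ?c b' \<times> (UNIV :: nat set)|"
      by (rule card_of_mono1)
    also have "|underS ?c b' \<times> (UNIV :: nat set)| <o ?c"
      by (rule card_of_Times_nat_ordLess[OF small_underS unc])
    finally show ?thesis using cov by (rule ordLess_ordIso_trans)
  qed
  with that show ?thesis by blast
qed

section \<open>Sets almost contained in all such open sets\<close>

text \<open>The \<open>n\<close>-th cover takes care of the \<open>n\<close>-th basic open set
  \<open>C n\<close>: by compactness, finitely many of its members meet every vertical line at a
  height in \<open>C n\<close>.\<close>

lemma dense_sections_subcover: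
  fixes X :: "(cantor \<times> cantor) set" and U :: "nat \<Rightarrow> (cantor \<times> cantor) set set"
  assumes X: "\<And>x V. open V \<Longrightarrow> V \<noteq> {} \<Longrightarrow> \<exists>y\<in>V. (x, y) \<in> X"
    and U: "\<And>n. open_cover X (U n)"
  obtains F W where "\<And>n. finite (F n) \<and> F n \<subseteq> U n" "dense_sections W" "X \<inter> W \<subseteq> (\<Union>n. \<Union>(F n))"
proof -
  have "\<forall>n V. \<exists>T. V \<in> U n \<longrightarrow> open T \<and> V = X \<inter> T"
    using U unfolding open_cover_def openin_open by metis
  then obtain T where T: "\<And>n V. V \<in> U n \<Longrightarrow> open (T n V) \<and> V = X \<inter> T n V" by metis
  \<comment> \<open>All cylinders are listed, since each finite pattern is the beginning of some
    \<open>digits k\<close>.\<close>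
  define C where "C n = (case prod_decode n of (m, k) \<Rightarrow> cyl m (digits k))" for n
  have C: "open (C n)" "C n \<noteq> {}" for n
    using open_cyl self_in_cyl[of "digits (snd (prod_decode n))" "fst (prod_decode n)"]
    by (auto simp: C_def case_prod_unfold)
  have C_base: "\<exists>n. C n \<subseteq> V" if V: "open V" "V \<noteq> {}" for V
  proof -
    obtain v where "v \<in> V" using V by blast
    then obtain m where m: "cyl m v \<subseteq> V" using open_imp_cyl V by blast
    obtain k where "flip (\<lambda>_. False) (digits k) \<in> cyl m v"
      using flip_digits_dense open_cyl self_in_cyl by (metis empty_iff)
    then have "cyl m (digits k) = cyl m v" by (auto simp: cyl_def flip_def)
    with m have "C (prod_encode (m, k)) \<subseteq> V" by (simp add: C_def)
    then show ?thesis ..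
  qed
  let ?G = "\<lambda>n V. fst ` (T n V \<inter> UNIV \<times> C n)"
  have "\<exists>F. F \<subseteq> U n \<and> finite F \<and> UNIV \<subseteq> (\<Union>V\<in>F. ?G n V)" for n
  proof -
    have "open (?G n V)" if "V \<in> U n" for V
      using T[OF that] C(1) by (intro open_image_fst open_Int open_Times) auto
    moreover have "UNIV \<subseteq> (\<Union>V\<in>U n. ?G n V)"
    proof
      fix x
      obtain y where y: "y \<in> C n" "(x, y) \<in> X" using X[OF C] by blast
      then obtain V where "V \<in> U n" "(x, y) \<in> V" using U unfolding open_cover_def by blast
      with y T show "x \<in> (\<Union>V\<in>U n. ?G n V)" by force
    qed
    ultimately show ?thesis using compactE_image[OF compact_cantor, of "U n" "?G n"] by metis
  qed
  then obtain F where F: "\<And>n. F n \<subseteq> U n" "\<And>n. finite (F n)" "\<And>n. UNIV \<subseteq> (\<Union>V\<in>F n. ?G n V)"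
    by metis
  \<comment> \<open>The members of \<open>F n\<close> are open only relative to \<open>X\<close>;
    their ambient extensions \<open>T n V\<close> make \<open>W\<close> open in the square.\<close>
  define W where "W = (\<Union>n. \<Union>V\<in>F n. T n V)"
  have "open W" unfolding W_def using T F(1) by (intro open_UN ballI) (blast dest: subsetD)
  moreover have "\<exists>y\<in>V. (x, y) \<in> W" if V: "open V" "V \<noteq> {}" for x V
  proof -
    obtain n where n: "C n \<subseteq> V" using C_base V by blast
    obtain S where S: "S \<in> F n" "x \<in> ?G n S" using F(3)[of n] by blast
    then obtain y where "(x, y) \<in> T n S" "y \<in> C n" by auto
    with n S(1) show ?thesis unfolding W_def by blast
  qed
  ultimately have W: "dense_sections W" by (simp add: dense_sections_def)
  have XW: "X \<inter> W \<subseteq> (\<Union>n. \<Union>(F n))"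
  proof
    fix p assume p: "p \<in> X \<inter> W"
    then obtain n V where V: "V \<in> F n" "p \<in> T n V" by (auto simp: W_def)
    then have "V = X \<inter> T n V" using T F(1) by blast
    with p V have "p \<in> V" by blast
    with V(1) show "p \<in> (\<Union>n. \<Union>(F n))" by blast
  qed
  have "finite (F n) \<and> F n \<subseteq> U n" for n using F(1,2) by blast
  then show ?thesis using W XW by (rule that)
qed

text \<open>With countable subcovers enumerated, each point yields the function of the indices that
  catch it. One \<open>g\<close> meeting all these functions selects a single set from each cover,
  and together these catch \<open>Y\<close>.\<close>

lemma few_points_selection:
  fixes X :: "'a::second_countable_topology set" and U :: "nat \<Rightarrow> 'a set set"
  assumes Y: "Y \<subseteq> X" "|Y| <o cov_meager" and U: "\<And>n. open_cover X (U n)"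
  obtains F where "\<And>n. finite (F n) \<and> F n \<subseteq> U n" "Y \<subseteq> (\<Union>n. \<Union>(F n))"
proof (cases "X = {}")
  case True
  with that[of "\<lambda>_. {}"] Y(1) show ?thesis by simp
next
  case False
  have "\<exists>v :: nat \<Rightarrow> 'a set. range v \<subseteq> U n \<and> X \<subseteq> \<Union>(range v)" for n
  proof -
    obtain U' where U': "U' \<subseteq> U n" "countable U'" "\<Union>U' = \<Union>(U n)"
      using Lindelof_openin[of "U n" X] U unfolding open_cover_def by blast
    then have "\<Union>U' = X" using U by (simp add: open_cover_def)
    \<comment> \<open>\<open>from_nat_into\<close> enumerates exactly the given countable set only
      if that set is nonempty; hence the separate case of empty \<open>X\<close>.\<close>
    moreover from this have "U' \<noteq> {}" using False by blast
    ultimately have "range (from_nat_into U') \<subseteq> U n \<and> X \<subseteq> \<Union>(range (from_nat_into U'))"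
      using U'(1,2) by (simp add: range_from_nat_into)
    then show ?thesis by (intro exI[of _ "from_nat_into U'"])
  qed
  then obtain v :: "nat \<Rightarrow> nat \<Rightarrow> 'a set" where
    v: "\<And>n. range (v n) \<subseteq> U n" "\<And>n. X \<subseteq> \<Union>(range (v n))" by metis
  have "\<forall>p n. \<exists>k. p \<in> X \<longrightarrow> p \<in> v n k" using v(2) by fastforce
  then obtain \<phi> where \<phi>: "\<And>p n. p \<in> X \<Longrightarrow> p \<in> v n (\<phi> p n)" by metis
  obtain g where "\<And>p. p \<in> Y \<Longrightarrow> \<exists>n. g n = \<phi> p n"
    using few_functions_met[OF Y(2), of \<phi>] by blast
  then have g: "\<exists>n. p \<in> v n (g n)" if "p \<in> Y" for p
    using \<phi> Y(1) that by (metis subsetD)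
  show ?thesis
  proof (rule that)
    show "finite {v n (g n)} \<and> {v n (g n)} \<subseteq> U n" for n using v(1)[of n] by blast
    show "Y \<subseteq> (\<Union>n. \<Union>{v n (g n)})" using g by auto
  qed
qed

text \<open>The same covers are used twice, for \<open>X \<inter> W\<close> and for
  \<open>X - W\<close>; the union of two finite selections from \<open>U n\<close> is still
  finite.\<close>

lemma few_exceptions_Menger:
  fixes X :: "(cantor \<times> cantor) set"
  assumes X: "\<And>x V. open V \<Longrightarrow> V \<noteq> {} \<Longrightarrow> \<exists>y\<in>V. (x, y) \<in> X"
    and few: "\<And>W. dense_sections W \<Longrightarrow> |X - W| <o cov_meager"
  shows "Menger X"
  unfolding Menger_def
proof (intro allI impI)
  fix U :: "nat \<Rightarrow> (cantor \<times> cantor) set set"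
  assume "\<forall>n. open_cover X (U n)"
  then have U: "\<And>n. open_cover X (U n)" by blast
  obtain F W where F: "\<And>n. finite (F n) \<and> F n \<subseteq> U n" "dense_sections W" "X \<inter> W \<subseteq> (\<Union>n. \<Union>(F n))"
    using dense_sections_subcover[of X U, OF X U] by blast
  obtain G where G: "\<And>n. finite (G n) \<and> G n \<subseteq> U n" "X - W \<subseteq> (\<Union>n. \<Union>(G n))"
    using few_points_selection[of "X - W" X U, OF Diff_subset few[OF F(2)] U] by blast
  have "X \<subseteq> (\<Union>n. \<Union>(F n \<union> G n))" using F(3) G(2) by blast
  moreover have "finite (F n \<union> G n) \<and> F n \<union> G n \<subseteq> U n" for n using F(1) G(1) by simp
  ultimately show "\<exists>F. (\<forall>n. finite (F n) \<and> F n \<subseteq> U n) \<and> X \<subseteq> (\<Union>n. \<Union>(F n))"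
    by (intro exI[of _ "\<lambda>n. F n \<union> G n"]) blast
qed

lemma few_exceptions_totally_imperfect:
  fixes X :: "(cantor \<times> cantor) set"
  assumes X: "\<And>x. countable {y. (x, y) \<in> X}"
    and few: "\<And>W. dense_sections W \<Longrightarrow> |X - W| <o |UNIV :: cantor set|"
  shows "totally_imperfect X"
  unfolding totally_imperfect_def
proof
  assume "\<exists>P. P \<subseteq> X \<and> P homeomorphic (UNIV :: cantor set)"
  then obtain P where P: "P \<subseteq> X" "P homeomorphic (UNIV :: cantor set)" by blast
  then have "compact P" using compact_cantor homeomorphic_compactness by blast
  then have "open (- P)" by (simp add: compact_imp_closed_cantor_square open_Compl)
  moreover have "\<exists>y\<in>V. (x, y) \<in> - P" if "open V" "V \<noteq> {}" for x V
  proof -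
    have "\<not> V \<subseteq> {y. (x, y) \<in> X}"
      using uncountable_open_cantor[OF that] X countable_subset by metis
    then show ?thesis using P(1) by blast
  qed
  ultimately have "dense_sections (- P)" by (simp add: dense_sections_def)
  then have "|X - (- P)| <o |UNIV :: cantor set|" by (rule few)
  then have "|P| <o |UNIV :: cantor set|" using P(1) by (simp add: Diff_Compl Int_absorb1)
  moreover obtain h k where hk: "homeomorphism P (UNIV :: cantor set) h k"
    using P(2) by (auto simp: homeomorphic_def)
  then have "bij_betw h P UNIV"
    unfolding homeomorphism_def by (intro bij_betw_byWitness[of _ k]) auto
  then have "|P| =o |UNIV :: cantor set|" by (rule card_of_ordIsoI)
  ultimately show False using not_ordLess_ordIso by blast
qed

theorem theorem3p1:
  assumes "cov_meager =o continuum"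
  shows "\<exists>X :: (cantor \<times> cantor) set. Menger X \<and> totally_imperfect X \<and> fst ` X = UNIV"
proof -
  have cov: "cov_meager =o |UNIV :: cantor set|"
    using cantor_ordIso_real assms[unfolded continuum_def] ordIso_symmetric ordIso_transitive by blast
  obtain f where f: "\<And>W. dense_sections W \<Longrightarrow> |{(x, n). (x, flip (f x) (digits n)) \<notin> W}| <o cov_meager"
    using generic_function[OF assms] by blast
  define X where "X = {(x, flip (f x) (digits n)) | x n. True}"
  have few: "|X - W| <o cov_meager" if W: "dense_sections W" for W
  proof -
    let ?E = "{(x, n). (x, flip (f x) (digits n)) \<notin> W}"
    \<comment> \<open>Each exceptional point comes from a pair \<open>(x, n)\<close>, so the bound
      on the pairs carries over.\<close>
    have "X - W \<subseteq> (\<lambda>(x, n). (x, flip (f x) (digits n))) ` ?E" by (auto simp: X_def)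
    then have "|X - W| \<le>o |?E|" by (rule surj_imp_ordLeq)
    then show ?thesis using f[OF W] by (rule ordLeq_ordLess_trans)
  qed
  have "\<exists>y\<in>V. (x, y) \<in> X" if V: "open V" "V \<noteq> {}" for x V
  proof -
    obtain n where "flip (f x) (digits n) \<in> V" using flip_digits_dense[OF V] by blast
    then show ?thesis unfolding X_def by blast
  qed
  then have "Menger X" using few by (rule few_exceptions_Menger)
  moreover have "totally_imperfect X"
  proof (rule few_exceptions_totally_imperfect)
    have "{y. (x, y) \<in> X} = range (\<lambda>n. flip (f x) (digits n))" for x by (auto simp: X_def)
    then show "countable {y. (x, y) \<in> X}" for x by simp
    show "|X - W| <o |UNIV :: cantor set|" if "dense_sections W" for W
      using few[OF that] cov by (rule ordLess_ordIso_trans)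
  qed
  moreover have "fst ` X = UNIV"
  proof -
    have "x \<in> fst ` X" for x
      by (rule image_eqI[of _ _ "(x, flip (f x) (digits 0))"]) (auto simp: X_def)
    then show ?thesis by blast
  qed
  ultimately show ?thesis by blast
qed

end
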